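(* Let $M$ be a manifold without boundary of dimension at least two, and let $\Gamma$ be a finite group of order $r$ which acts freely on $M$. Then the orbit configuration space bundle $p_\Gamma:F_\Gamma(M,n+1)\to F_\Gamma(M,n)$, given by projection onto the first $n$ coordinates, is equivalent to the pullback of the bundle $p_{rn+1}:F(M,rn+1)\to F(M,rn)$ of classical configuration spaces (projection onto the first $rn$ coordinates) along the map $f:F_\Gamma(M,n)\to F(M,rn)$, $f(x_1,\dots,x_n)=(\Gamma\cdot x_1,\dots,\Gamma\cdot x_n)$.
   Context: $F(M,n)=\{(x_1,\dots,x_n)\in M^n\mid x_i\ne x_j\text{ if }i\ne j\}$ is the configuration space, and $F_\Gamma(M,n)=\{(x_1,\dots,x_n)\in M^n\mid\Gamma\cdot x_i\cap\Gamma\cdot x_j=\emptyset\text{ if }i\ne j\}$ is the orbit configuration space. In the definition of $f$, each orbit $\Gamma\cdot x_i$ is listed as the $r$-tuple $(\gamma_1x_i,\dots,\gamma_rx_i)$ for a fixed ordering $\gamma_1,\dots,\gamma_r$ of $\Gamma$. *)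

theory Defs
  imports "HOL-Analysis.Analysis" "HOL-Algebra.Group_Action"
begin

definition topological_manifold :: "nat \<Rightarrow> 'a topology \<Rightarrow> bool" where
  "topological_manifold d M \<longleftrightarrow>
     Hausdorff_space M \<and> second_countable M \<and>
     (\<forall>x\<in>topspace M. \<exists>U V. openin M U \<and> x \<in> U \<and> openin (Euclidean_space d) V \<and>
        subtopology M U homeomorphic_space subtopology (Euclidean_space d) V)"

text \<open>Since \<^term>\<open>G\<close> carries no topology, a continuous action is one by continuous maps.\<close>

definition acts_freely_on ::
    "('g, 'm) monoid_scheme \<Rightarrow> ('g \<Rightarrow> 'a \<Rightarrow> 'a) \<Rightarrow> 'a topology \<Rightarrow> bool" where
  "acts_freely_on G \<phi> M \<longleftrightarrow>
     group_action G (topspace M) \<phi> \<and>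
     (\<forall>g\<in>carrier G. continuous_map M M (\<phi> g)) \<and>
     (\<forall>g\<in>carrier G. \<forall>x\<in>topspace M. \<phi> g x = x \<longrightarrow> g = \<one>\<^bsub>G\<^esub>)"

text \<open>Points of \<open>M\<^sup>n\<close> are the extensional functions on \<open>{..<n}\<close>, so coordinates are numbered from
  0.\<close>

definition configuration_space :: "'a topology \<Rightarrow> nat \<Rightarrow> (nat \<Rightarrow> 'a) topology" where
  "configuration_space M n =
     subtopology (product_topology (\<lambda>_. M) {..<n})
       {x. \<forall>i<n. \<forall>j<n. i \<noteq> j \<longrightarrow> x i \<noteq> x j}"

definition orbit_configuration_space ::
    "('g, 'm) monoid_scheme \<Rightarrow> ('g \<Rightarrow> 'a \<Rightarrow> 'a) \<Rightarrow> 'a topology \<Rightarrow> nat \<Rightarrow> (nat \<Rightarrow> 'a) topology" where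
  "orbit_configuration_space G \<phi> M n =
     subtopology (product_topology (\<lambda>_. M) {..<n})
       {x. \<forall>i<n. \<forall>j<n. i \<noteq> j \<longrightarrow> orbit G \<phi> (x i) \<inter> orbit G \<phi> (x j) = {}}"

definition first_coords :: "nat \<Rightarrow> (nat \<Rightarrow> 'a) \<Rightarrow> nat \<Rightarrow> 'a" where
  "first_coords n x = restrict x {..<n}"

text \<open>The orbits of \<open>x 0, \<dots>, x (n - 1)\<close> one after the other, each listed in the order
  \<open>\<gamma> 0, \<dots>, \<gamma> (r - 1)\<close>: coordinate \<open>i * r + j\<close> is \<open>\<phi> (\<gamma> j) (x i)\<close>.\<close>

definition orbit_listing ::
    "('g \<Rightarrow> 'a \<Rightarrow> 'a) \<Rightarrow> (nat \<Rightarrow> 'g) \<Rightarrow> nat \<Rightarrow> nat \<Rightarrow> (nat \<Rightarrow> 'a) \<Rightarrow> nat \<Rightarrow> 'a" where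
  "orbit_listing \<phi> \<gamma> r n x = (\<lambda>k\<in>{..<r * n}. \<phi> (\<gamma> (k mod r)) (x (k div r)))"

text \<open>The total space of the pullback of \<open>p\<close>, defined on \<open>E\<close>, along \<open>f\<close>, defined on \<open>B\<close>; its
  projection to \<open>B\<close> is \<^const>\<open>fst\<close>.\<close>

definition pullback_space ::
    "'b topology \<Rightarrow> ('b \<Rightarrow> 'c) \<Rightarrow> 'e topology \<Rightarrow> ('e \<Rightarrow> 'c) \<Rightarrow> ('b \<times> 'e) topology" where
  "pullback_space B f E p = subtopology (prod_topology B E) {(b, e). f b = p e}"

text \<open>Equivalence of bundles over the same base: a homeomorphism of total spaces covering the
  identity of \<open>B\<close>.\<close>

definition bundle_equivalent ::
    "'b topology \<Rightarrow> 'e topology \<Rightarrow> ('e \<Rightarrow> 'b) \<Rightarrow> 'f topology \<Rightarrow> ('f \<Rightarrow> 'b) \<Rightarrow> bool" where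
  "bundle_equivalent B E p E' p' \<longleftrightarrow>
     continuous_map E B p \<and> continuous_map E' B p' \<and>
     (\<exists>h. homeomorphic_map E E' h \<and> (\<forall>e\<in>topspace E. p' (h e) = p e))"

end

theory Submission
  imports Defs
begin

text \<open>
  Both total spaces are described by pairs \<open>(b, y)\<close> where \<open>b\<close> is a point of the orbit configuration
  space and \<open>y\<close> is a point of \<open>M\<close> outside the orbits of the coordinates of \<open>b\<close>. In the orbit
  configuration space of \<open>n + 1\<close> points this is because distinct orbits are disjoint; in the
  pullback it is because the listing of \<open>b\<close> enumerates exactly the union of these orbits, without
  repetition since the action is free.
\<close>

section \<open>Points, coordinates and continuity in the two configuration spaces\<close>

lemma topspace_configuration_space:
  "topspace (configuration_space M n) = {x \<in> {..<n} \<rightarrow>\<^sub>E topspace M. inj_on x {..<n}}"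
  by (auto simp: configuration_space_def topspace_subtopology inj_on_def)

lemma topspace_orbit_configuration_space:
  "topspace (orbit_configuration_space G \<phi> M n) =
     {x \<in> {..<n} \<rightarrow>\<^sub>E topspace M.
        \<forall>i<n. \<forall>j<n. i \<noteq> j \<longrightarrow> orbit G \<phi> (x i) \<inter> orbit G \<phi> (x j) = {}}"
  by (auto simp: orbit_configuration_space_def topspace_subtopology)

text \<open>Subspaces of a product carry the topology of coordinatewise convergence, so the
  coordinates decide continuity. The second hypothesis also provides the extensionality of each
  \<open>f x\<close>.\<close>

lemma continuous_map_configuration_space:
  assumes "\<And>k. k < n \<Longrightarrow> continuous_map X M (\<lambda>x. f x k)"
    and "f ` topspace X \<subseteq> topspace (configuration_space M n)"
  shows "continuous_map X (configuration_space M n) f"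
  using assms
  by (auto simp: configuration_space_def continuous_map_in_subtopology
      continuous_map_componentwise topspace_subtopology image_subset_iff PiE_def)

lemma continuous_map_orbit_configuration_space:
  assumes "\<And>k. k < n \<Longrightarrow> continuous_map X M (\<lambda>x. f x k)"
    and "f ` topspace X \<subseteq> topspace (orbit_configuration_space G \<phi> M n)"
  shows "continuous_map X (orbit_configuration_space G \<phi> M n) f"
  using assms
  by (auto simp: orbit_configuration_space_def continuous_map_in_subtopology
      continuous_map_componentwise topspace_subtopology image_subset_iff PiE_def)

lemma continuous_map_configuration_space_coord:
  "k < n \<Longrightarrow> continuous_map (configuration_space M n) M (\<lambda>x. x k)"
  unfolding configuration_space_def
  by (intro continuous_map_from_subtopology continuous_map_product_projection) simp

lemma continuous_map_orbit_configuration_space_coord: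
  "k < n \<Longrightarrow> continuous_map (orbit_configuration_space G \<phi> M n) M (\<lambda>x. x k)"
  unfolding orbit_configuration_space_def
  by (intro continuous_map_from_subtopology continuous_map_product_projection) simp

section \<open>Forgetting the last point and adjoining a new one\<close>

lemma first_coords_fun_upd: "b \<in> extensional {..<n} \<Longrightarrow> first_coords n (b(n := y)) = b"
  by (auto simp: first_coords_def extensional_def fun_eq_iff)

lemma fun_upd_first_coords: "x \<in> extensional {..<Suc n} \<Longrightarrow> (first_coords n x)(n := x n) = x"
  by (auto simp: first_coords_def extensional_def fun_eq_iff)

lemma first_coords_configuration_space:
  "x \<in> topspace (configuration_space M (Suc n)) \<Longrightarrow>
     first_coords n x \<in> topspace (configuration_space M n)"
  by (auto simp: topspace_configuration_space first_coords_def inj_on_def)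

lemma first_coords_orbit_configuration_space:
  "x \<in> topspace (orbit_configuration_space G \<phi> M (Suc n)) \<Longrightarrow>
     first_coords n x \<in> topspace (orbit_configuration_space G \<phi> M n)"
  by (auto simp: topspace_orbit_configuration_space first_coords_def)

lemma continuous_map_first_coords_configuration_space:
  "continuous_map (configuration_space M (Suc n)) (configuration_space M n) (first_coords n)"
proof (rule continuous_map_configuration_space)
  show "continuous_map (configuration_space M (Suc n)) M (\<lambda>x. first_coords n x k)" if "k < n" for k
    using continuous_map_configuration_space_coord[of k "Suc n" M] that
    by (simp add: first_coords_def)
qed (use first_coords_configuration_space in blast)

lemma continuous_map_first_coords_orbit_configuration_space:
  "continuous_map (orbit_configuration_space G \<phi> M (Suc n)) (orbit_configuration_space G \<phi> M n)
     (first_coords n)"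
proof (rule continuous_map_orbit_configuration_space)
  show "continuous_map (orbit_configuration_space G \<phi> M (Suc n)) M (\<lambda>x. first_coords n x k)"
    if "k < n" for k
    using continuous_map_orbit_configuration_space_coord[of k "Suc n" G \<phi> M] that
    by (simp add: first_coords_def)
qed (use first_coords_orbit_configuration_space in blast)

text \<open>Only the pairs of indices involving \<open>n\<close> are new. This identifies the fibre
  of the projection over \<open>b\<close> with the complement in \<open>M\<close> of the points of
  \<open>b\<close>.\<close>

lemma configuration_space_fun_upd:
  assumes "b \<in> topspace (configuration_space M n)"
  shows "b(n := y) \<in> topspace (configuration_space M (Suc n)) \<longleftrightarrow>
           y \<in> topspace M \<and> y \<notin> b ` {..<n}"
proof -
  have "inj_on (b(n := y)) {..<Suc n} \<longleftrightarrow> y \<notin> b ` {..<n}"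
    using assms by (auto simp: topspace_configuration_space lessThan_Suc inj_on_def)
  moreover have "b(n := y) \<in> {..<Suc n} \<rightarrow>\<^sub>E topspace M \<longleftrightarrow> y \<in> topspace M"
    using assms by (auto simp: topspace_configuration_space PiE_def extensional_def Pi_iff less_Suc_eq)
  ultimately show ?thesis by (simp add: topspace_configuration_space)
qed

text \<open>Orbits are equivalence classes: a common point would link \<open>x\<close> to
  \<open>y\<close> by symmetry and transitivity.\<close>

lemma (in group_action) orbit_disjoint_iff:
  assumes "x \<in> E" "y \<in> E"
  shows "orbit G \<phi> x \<inter> orbit G \<phi> y = {} \<longleftrightarrow> y \<notin> orbit G \<phi> x"
proof
  show "y \<notin> orbit G \<phi> x" if "orbit G \<phi> x \<inter> orbit G \<phi> y = {}"
    using orbit_refl[OF assms(2)] that by blast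
next
  assume y: "y \<notin> orbit G \<phi> x"
  have False if z: "z \<in> orbit G \<phi> x" "z \<in> orbit G \<phi> y" for z
  proof -
    have "z \<in> E" using z assms element_image unfolding orbit_def by blast
    then show False using y z assms orbit_sym orbit_trans by blast
  qed
  then show "orbit G \<phi> x \<inter> orbit G \<phi> y = {}" by blast
qed

text \<open>The orbit analogue of the fibre description: here the complement of the orbits through
  \<open>b\<close>. Disjointness of orbits turns into non-membership of the single point
  \<open>y\<close>.\<close>

lemma orbit_configuration_space_fun_upd:
  assumes "group_action G (topspace M) \<phi>"
    and "b \<in> topspace (orbit_configuration_space G \<phi> M n)"
  shows "b(n := y) \<in> topspace (orbit_configuration_space G \<phi> M (Suc n)) \<longleftrightarrow>
           y \<in> topspace M \<and> y \<notin> (\<Union>i<n. orbit G \<phi> (b i))"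
proof -
  have disj: "orbit G \<phi> (b i) \<inter> orbit G \<phi> (b j) = {}" if "i < n" "j < n" "i \<noteq> j" for i j
    using assms(2) that by (auto simp: topspace_orbit_configuration_space)
  have b: "b \<in> {..<n} \<rightarrow>\<^sub>E topspace M"
    using assms(2) by (auto simp: topspace_orbit_configuration_space)
  have "b(n := y) \<in> {..<Suc n} \<rightarrow>\<^sub>E topspace M \<longleftrightarrow> y \<in> topspace M"
    using b by (auto simp: PiE_def extensional_def Pi_iff less_Suc_eq)
  moreover have "(\<forall>i<Suc n. \<forall>j<Suc n. i \<noteq> j \<longrightarrow>
      orbit G \<phi> ((b(n := y)) i) \<inter> orbit G \<phi> ((b(n := y)) j) = {}) \<longleftrightarrow>
      (\<forall>i<n. orbit G \<phi> (b i) \<inter> orbit G \<phi> y = {})"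
    using disj by (auto simp: less_Suc_eq Int_commute)
  \<comment> \<open>The orbit relation is an equivalence on \<open>M\<close> only, so this holds
    under \<open>y \<in> topspace M\<close>; \<open>conj_cong\<close> makes that conjunct available
    below.\<close>
  moreover have "(\<forall>i<n. orbit G \<phi> (b i) \<inter> orbit G \<phi> y = {}) \<longleftrightarrow> y \<notin> (\<Union>i<n. orbit G \<phi> (b i))"
    if "y \<in> topspace M"
  proof -
    have "orbit G \<phi> (b i) \<inter> orbit G \<phi> y = {} \<longleftrightarrow> y \<notin> orbit G \<phi> (b i)" if "i < n" for i
      using group_action.orbit_disjoint_iff[OF assms(1) _ \<open>y \<in> topspace M\<close>] PiE_mem[OF b] that
      by simp
    then show ?thesis by blast
  qed
  ultimately show ?thesis
    unfolding topspace_orbit_configuration_space mem_Collect_eq by (simp cong: conj_cong)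
qed

section \<open>The listing of orbits as a continuous map\<close>

lemma mod_less_factor: "k mod r < r" and div_less_factor: "k div r < n"
  if "k < r * n" for k r n :: nat
  \<comment> \<open>\<open>k < r * n\<close> excludes \<open>r = 0\<close>, which is what
    \<open>k mod r < r\<close> requires.\<close>
  using that by (auto simp: less_mult_imp_div_less mult.commute intro!: mod_less_divisor gr0I)

lemma orbit_listing_image:
  assumes "bij_betw \<gamma> {..<r} (carrier G)"
  shows "orbit_listing \<phi> \<gamma> r n b ` {..<r * n} = (\<Union>i<n. orbit G \<phi> (b i))"
proof (intro equalityI subsetI)
  fix y assume "y \<in> orbit_listing \<phi> \<gamma> r n b ` {..<r * n}"
  then obtain k where k: "k < r * n" and y: "y = \<phi> (\<gamma> (k mod r)) (b (k div r))"
    by (auto simp: orbit_listing_def)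
  have "\<gamma> (k mod r) \<in> carrier G"
    using assms mod_less_factor[OF k] by (auto simp: bij_betw_def)
  then show "y \<in> (\<Union>i<n. orbit G \<phi> (b i))"
    using y div_less_factor[OF k] by (auto simp: orbit_def)
next
  fix y assume "y \<in> (\<Union>i<n. orbit G \<phi> (b i))"
  then obtain i g where i: "i < n" "g \<in> carrier G" "y = \<phi> g (b i)"
    by (auto simp: orbit_def)
  then obtain j where j: "j < r" "g = \<gamma> j"
    using assms by (auto simp: bij_betw_def)
  \<comment> \<open>The position of \<open>y\<close> is \<open>i * r + j\<close>: since
    \<open>j < r\<close>, its quotient by \<open>r\<close> is \<open>i\<close> and its remainder is
    \<open>j\<close>.\<close>
  have "i * r + j < Suc i * r" using j by simp
  also have "\<dots> \<le> n * r" using i by (intro mult_le_mono1) simp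
  finally have lt: "i * r + j < r * n" by (simp add: mult.commute)
  then have "orbit_listing \<phi> \<gamma> r n b (i * r + j) = y"
    using i j by (simp add: orbit_listing_def)
  then show "y \<in> orbit_listing \<phi> \<gamma> r n b ` {..<r * n}"
    using lt by blast
qed

text \<open>If \<open>g\<close> and \<open>h\<close> move \<open>x\<close> to the same point, then
  \<open>h\<close> inverse times \<open>g\<close> fixes \<open>x\<close>, hence is the identity by
  freeness.\<close>

lemma orbit_map_inj_on:
  assumes "acts_freely_on G \<phi> M" "x \<in> topspace M"
  shows "inj_on (\<lambda>g. \<phi> g x) (carrier G)"
proof (rule inj_onI)
  fix g h assume gh: "g \<in> carrier G" "h \<in> carrier G" "\<phi> g x = \<phi> h x"
  interpret group_action G "topspace M" \<phi>
    using assms(1) by (simp add: acts_freely_on_def)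
  interpret group G
    using group_hom group_hom.axioms(1) by blast
  have "\<phi> (inv\<^bsub>G\<^esub> h \<otimes>\<^bsub>G\<^esub> g) x = x"
    using gh assms(2) composition_rule[of x "inv\<^bsub>G\<^esub> h" g] orbit_sym_aux[of h x] by simp
  then have "inv\<^bsub>G\<^esub> h \<otimes>\<^bsub>G\<^esub> g = \<one>\<^bsub>G\<^esub>"
    using assms gh by (auto simp: acts_freely_on_def)
  then show "g = h"
    using gh by (metis inv_equality inv_inv inv_closed)
qed

text \<open>A position is recovered from its entry in two stages: disjointness of the orbits
  determines the quotient by \<open>r\<close>, then freeness and the injectivity of
  \<open>\<gamma>\<close> determine the remainder.\<close>

lemma orbit_listing_configuration_space:
  assumes "acts_freely_on G \<phi> M" "bij_betw \<gamma> {..<r} (carrier G)"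
    and "b \<in> topspace (orbit_configuration_space G \<phi> M n)"
  shows "orbit_listing \<phi> \<gamma> r n b \<in> topspace (configuration_space M (r * n))"
proof -
  interpret group_action G "topspace M" \<phi>
    using assms(1) by (simp add: acts_freely_on_def)
  have bM: "b i \<in> topspace M" if "i < n" for i
    using assms(3) that by (auto simp: topspace_orbit_configuration_space)
  have disj: "orbit G \<phi> (b i) \<inter> orbit G \<phi> (b j) = {}" if "i < n" "j < n" "i \<noteq> j" for i j
    using assms(3) that by (auto simp: topspace_orbit_configuration_space)
  have \<gamma>: "\<gamma> j \<in> carrier G" if "j < r" for j
    using assms(2) that by (auto simp: bij_betw_def)
  have "inj_on (orbit_listing \<phi> \<gamma> r n b) {..<r * n}"
  proof (rule inj_onI)
    fix k l assume kl: "k \<in> {..<r * n}" "l \<in> {..<r * n}"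
      and eq: "orbit_listing \<phi> \<gamma> r n b k = orbit_listing \<phi> \<gamma> r n b l"
    have k: "k mod r < r" "k div r < n" and l: "l mod r < r" "l div r < n"
      using kl by (auto intro: mod_less_factor div_less_factor)
    have eq': "\<phi> (\<gamma> (k mod r)) (b (k div r)) = \<phi> (\<gamma> (l mod r)) (b (l div r))"
      using eq kl by (simp add: orbit_listing_def)
    moreover have "\<phi> (\<gamma> (k mod r)) (b (k div r)) \<in> orbit G \<phi> (b (k div r))"
      and "\<phi> (\<gamma> (l mod r)) (b (l div r)) \<in> orbit G \<phi> (b (l div r))"
      using \<gamma> k l by (auto simp: orbit_def)
    \<comment> \<open>The common entry lies in both orbits.\<close>
    ultimately have "orbit G \<phi> (b (k div r)) \<inter> orbit G \<phi> (b (l div r)) \<noteq> {}"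
      by (metis disjoint_iff)
    then have div: "k div r = l div r"
      using disj k l by blast
    then have "\<gamma> (k mod r) = \<gamma> (l mod r)"
      using eq' inj_onD[OF orbit_map_inj_on[OF assms(1) bM]] \<gamma> k l by simp
    then have "k mod r = l mod r"
      using assms(2) k l by (auto simp: bij_betw_def dest: inj_onD)
    with div show "k = l" by (metis div_mult_mod_eq)
  qed
  moreover have "orbit_listing \<phi> \<gamma> r n b k \<in> topspace M" if "k < r * n" for k
    using that element_image[OF \<gamma> bM refl] mod_less_factor[OF that] div_less_factor[OF that]
    by (simp add: orbit_listing_def)
  ultimately show ?thesis
    by (auto simp: topspace_configuration_space orbit_listing_def)
qed

text \<open>Each coordinate is a coordinate projection followed by the action of one fixed group
  element.\<close>

lemma continuous_map_orbit_listing: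
  assumes "acts_freely_on G \<phi> M" "bij_betw \<gamma> {..<r} (carrier G)"
  shows "continuous_map (orbit_configuration_space G \<phi> M n) (configuration_space M (r * n))
           (orbit_listing \<phi> \<gamma> r n)"
proof (rule continuous_map_configuration_space)
  fix k assume k: "k < r * n"
  have "\<gamma> (k mod r) \<in> carrier G"
    using assms(2) mod_less_factor[OF k] by (auto simp: bij_betw_def)
  then have "continuous_map M M (\<phi> (\<gamma> (k mod r)))"
    using assms(1) by (simp add: acts_freely_on_def)
  from continuous_map_compose[OF continuous_map_orbit_configuration_space_coord this]
  show "continuous_map (orbit_configuration_space G \<phi> M n) M (\<lambda>x. orbit_listing \<phi> \<gamma> r n x k)"
    using k div_less_factor[OF k] by (simp add: orbit_listing_def o_def)
qed (use orbit_listing_configuration_space[OF assms] in blast)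

section \<open>Comparison of the orbit bundle with the pullback\<close>

theorem theorem2p1p2:
  fixes M :: "'a topology" and G :: "('g, 'm) monoid_scheme"
    and \<phi> :: "'g \<Rightarrow> 'a \<Rightarrow> 'a" and \<gamma> :: "nat \<Rightarrow> 'g" and d r n :: nat
  assumes "topological_manifold d M" and "2 \<le> d"
    and "group G" and "finite (carrier G)" and "Coset.order G = r"
    and "acts_freely_on G \<phi> M"
    and "bij_betw \<gamma> {..<r} (carrier G)"
  shows "continuous_map (orbit_configuration_space G \<phi> M n) (configuration_space M (r * n))
           (orbit_listing \<phi> \<gamma> r n) \<and>
         continuous_map (configuration_space M (r * n + 1)) (configuration_space M (r * n))
           (first_coords (r * n)) \<and>
         bundle_equivalent (orbit_configuration_space G \<phi> M n)
           (orbit_configuration_space G \<phi> M (n + 1)) (first_coords n)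
           (pullback_space (orbit_configuration_space G \<phi> M n) (orbit_listing \<phi> \<gamma> r n)
              (configuration_space M (r * n + 1)) (first_coords (r * n))) fst"
proof (intro conjI)
  let ?B = "orbit_configuration_space G \<phi> M n" and ?E = "orbit_configuration_space G \<phi> M (Suc n)"
  let ?C = "configuration_space M (r * n)" and ?D = "configuration_space M (Suc (r * n))"
  let ?f = "orbit_listing \<phi> \<gamma> r n"
  let ?P = "pullback_space ?B ?f ?D (first_coords (r * n))"
  \<comment> \<open>Numbering starts at 0, so the extra point has index \<open>n\<close> in
    \<open>?E\<close> and \<open>r * n\<close> in \<open>?D\<close>. The map \<open>h\<close> moves
    it from the end of \<open>x\<close> to the end of the listing; \<open>k\<close> moves it
    back.\<close>
  define h where "h x = (first_coords n x, (?f (first_coords n x))(r * n := x n))" for x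
  define k where "k = (\<lambda>(b :: nat \<Rightarrow> 'a, e :: nat \<Rightarrow> 'a). b(n := e (r * n)))"
  have act: "group_action G (topspace M) \<phi>"
    using assms by (simp add: acts_freely_on_def)
  note listing = orbit_listing_configuration_space[OF assms(6,7)]
  show cf: "continuous_map ?B ?C ?f"
    using assms by (intro continuous_map_orbit_listing)
  show "continuous_map (configuration_space M (r * n + 1)) ?C (first_coords (r * n))"
    using continuous_map_first_coords_configuration_space by simp
  have P: "topspace ?P = {(b, e). b \<in> topspace ?B \<and> e \<in> topspace ?D \<and> ?f b = first_coords (r * n) e}"
    by (auto simp: pullback_space_def topspace_subtopology)
  \<comment> \<open>Restriction and update at the last index undo each other only for functions that
    are \<open>undefined\<close> beyond it; hence these extensionality facts.\<close>
  have extB: "b \<in> extensional {..<n}" if "b \<in> topspace ?B" for b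
    using that by (auto simp: topspace_orbit_configuration_space PiE_def)
  have extE: "x \<in> extensional {..<Suc n}" if "x \<in> topspace ?E" for x
    using that by (auto simp: topspace_orbit_configuration_space PiE_def)
  have extD: "e \<in> extensional {..<Suc (r * n)}" if "e \<in> topspace ?D" for e
    using that by (auto simp: topspace_configuration_space PiE_def)
  have ext_f: "?f b \<in> extensional {..<r * n}" for b
    by (simp add: orbit_listing_def)
  \<comment> \<open>The fibres agree: both sides say that \<open>y\<close> is a point of
    \<open>M\<close> outside the orbits of \<open>b\<close>, because the entries of
    \<open>?f b\<close> are exactly the points of these orbits.\<close>
  have upd_iff: "(?f b)(r * n := y) \<in> topspace ?D \<longleftrightarrow> b(n := y) \<in> topspace ?E"
    if "b \<in> topspace ?B" for b y
    unfolding configuration_space_fun_upd[OF listing[OF that]]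
      orbit_configuration_space_fun_upd[OF act that] orbit_listing_image[OF assms(7)] by (rule refl)
  have h_in: "h x \<in> topspace ?P" if x: "x \<in> topspace ?E" for x
    using first_coords_orbit_configuration_space[OF x] upd_iff x
    by (simp add: P h_def first_coords_fun_upd[OF ext_f] fun_upd_first_coords[OF extE])
  \<comment> \<open>The pullback equation fixes all coordinates of \<open>e\<close> but the last, so
    \<open>b\<close> and \<open>e (r * n)\<close> determine the pair.\<close>
  have e_eq: "(?f b)(r * n := e (r * n)) = e" if "(b, e) \<in> topspace ?P" for b e
    using that by (simp add: P fun_upd_first_coords[OF extD])
  have k_in: "k z \<in> topspace ?E" if "z \<in> topspace ?P" for z
  proof -
    obtain b e where z: "z = (b, e)" by fastforce
    then have "b \<in> topspace ?B" "e \<in> topspace ?D"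
      using that by (simp_all add: P)
    then show ?thesis
      using upd_iff[of b "e (r * n)"] e_eq[of b e] that by (simp add: z k_def)
  qed
  \<comment> \<open>Continuity into the pullback splits into continuity into the product and the
    pullback equation, which \<open>h_in\<close> contains.\<close>
  have cont_h: "continuous_map ?E ?P h"
    unfolding pullback_space_def continuous_map_in_subtopology
  proof
    have p: "continuous_map ?E ?B (first_coords n)"
      by (rule continuous_map_first_coords_orbit_configuration_space)
    have "continuous_map ?E ?D (\<lambda>x. (?f (first_coords n x))(r * n := x n))"
    proof (rule continuous_map_configuration_space)
      fix j assume j: "j < Suc (r * n)"
      show "continuous_map ?E M (\<lambda>x. ((?f (first_coords n x))(r * n := x n)) j)"
      proof (cases "j = r * n")
        case True
        then show ?thesis
          using continuous_map_orbit_configuration_space_coord[of n "Suc n" G \<phi> M] by simp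
      next
        case False
        then have "j < r * n" using j by simp
        \<comment> \<open>The earlier coordinates are those of the listing after the projection to
          the base.\<close>
        from continuous_map_compose[OF continuous_map_compose[OF p cf]
            continuous_map_configuration_space_coord[OF this]]
        show ?thesis using False by (simp add: o_def)
      qed
    qed (use h_in in \<open>auto simp: P h_def\<close>)
    with p show "continuous_map ?E (prod_topology ?B ?D) h"
      unfolding h_def by (intro continuous_map_pairedI)
    show "h \<in> topspace ?E \<rightarrow> {(b, e). ?f b = first_coords (r * n) e}"
      using h_in by (simp add: P case_prod_unfold)
  qed
  \<comment> \<open>The coordinates of \<open>k (b, e)\<close> are those of \<open>b\<close>,
    followed by the last one of \<open>e\<close>.\<close>
  have cont_k: "continuous_map ?P ?E k"
  proof (rule continuous_map_orbit_configuration_space)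
    fix j assume j: "j < Suc n"
    show "continuous_map ?P M (\<lambda>z. k z j)"
    proof (cases "j = n")
      case True
      have "continuous_map ?P M (\<lambda>z. snd z (r * n))"
        unfolding pullback_space_def
        using continuous_map_compose[OF continuous_map_snd
            continuous_map_configuration_space_coord[of "r * n" "Suc (r * n)" M]]
        by (auto simp: o_def intro!: continuous_map_from_subtopology)
      then show ?thesis using True by (simp add: k_def case_prod_unfold)
    next
      case False
      then have "j < n" using j by simp
      then have "continuous_map ?P M (\<lambda>z. fst z j)"
        unfolding pullback_space_def
        using continuous_map_compose[OF continuous_map_fst
            continuous_map_orbit_configuration_space_coord[of j n G \<phi> M]]
        by (auto simp: o_def intro!: continuous_map_from_subtopology)
      then show ?thesis using False by (simp add: k_def case_prod_unfold)
    qed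
  qed (use k_in in blast)
  have kh: "k (h x) = x" if "x \<in> topspace ?E" for x
    using that by (simp add: h_def k_def fun_upd_first_coords[OF extE])
  have hk: "h (k z) = z" if "z \<in> topspace ?P" for z
  proof -
    obtain b e where z: "z = (b, e)" by fastforce
    then have "b \<in> topspace ?B" using that by (simp add: P)
    then show ?thesis
      using e_eq that by (simp add: z h_def k_def first_coords_fun_upd[OF extB])
  qed
  have "homeomorphic_maps ?E ?P h k"
    unfolding homeomorphic_maps_def using cont_h cont_k kh hk by blast
  then have "homeomorphic_map ?E ?P h"
    by (rule homeomorphic_maps_imp_map)
  moreover have "continuous_map ?P ?B fst"
    unfolding pullback_space_def by (intro continuous_map_from_subtopology continuous_map_fst)
  \<comment> \<open>The first component of \<open>h x\<close> is \<open>first_coords n x\<close>, so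
    \<open>h\<close> covers the identity of the base.\<close>
  ultimately have "bundle_equivalent ?B ?E (first_coords n) ?P fst"
    unfolding bundle_equivalent_def
    using continuous_map_first_coords_orbit_configuration_space by (auto simp: h_def)
  then show "bundle_equivalent ?B (orbit_configuration_space G \<phi> M (n + 1)) (first_coords n)
      (pullback_space ?B ?f (configuration_space M (r * n + 1)) (first_coords (r * n))) fst"
    by simp
qed

end
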